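(* Let $(X,\mathcal{V})$ be a semi-coarse space, and let $\{(X,\mathcal{V}^{kPE}),f_i^j,\mathbb{N}\}_{k=0}^\infty$ be the directed system of semi-coarse spaces in which all the maps $f_i^j:(X,\mathcal{V}^{iPE})\to(X,\mathcal{V}^{jPE})$, $i\le j$, are the identity map of $X$. Then $\varinjlim\{(X,\mathcal{V}^{kPE}),f_i^j,\mathbb{N}\}$ is a coarse space.
   Context: For $A,B\subset X\times X$ put $A^{-1}=\{(y,x):(x,y)\in A\}$ and $A\circ B=\{(x,y):\exists z\in X,\ (x,z)\in A,\ (z,y)\in B\}$. A semi-coarse structure on $X$ is a collection $\mathcal{V}$ of subsets of $X\times X$ containing the diagonal $\Delta_X$ and closed under subsets, finite unions and inverses; $(X,\mathcal V)$ is a semi-coarse space. It is a coarse structure (and $(X,\mathcal{V})$ a coarse space) if moreover $A\circ B\in\mathcal{V}$ whenever $A,B\in\mathcal{V}$. A map $f:(X,\mathcal V)\to(Y,\mathcal W)$ is bornologous if $(f\times f)(V)\in\mathcal W$ for all $V\in\mathcal V$. The set product extension of a semi-coarse structure $\mathcal{V}$ is $\mathcal{V}^{PE}=\{C\subset X\times X:\exists A,B\in\mathcal{V}\text{ with }C\subset A\circ B\}$, which is again a semi-coarse structure and contains $\mathcal{V}$. Put $\mathcal{V}^{0PE}=\mathcal{V}$ and, recursively, let $\mathcal{V}^{kPE}$ be the set product extension of $\mathcal{V}^{(k-1)PE}$. The direct limit is taken in the category of semi-coarse spaces and bornologous maps; for such a directed system of increasing structures on a fixed set with identity maps, the direct limit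 is $\left(X,\bigcup_{k}\mathcal{V}^{kPE}\right)$. *)

theory Defs
  imports Main "HOL-Library.FuncSet"
begin

definition semi_coarse_space :: "'a set \<Rightarrow> ('a \<times> 'a) set set \<Rightarrow> bool" where
  "semi_coarse_space X V \<longleftrightarrow>
     V \<subseteq> Pow (X \<times> X) \<and> Id_on X \<in> V \<and>
     (\<forall>A\<in>V. \<forall>B. B \<subseteq> A \<longrightarrow> B \<in> V) \<and>
     (\<forall>A\<in>V. \<forall>B\<in>V. A \<union> B \<in> V) \<and>
     (\<forall>A\<in>V. A\<inverse> \<in> V)"

definition coarse_space :: "'a set \<Rightarrow> ('a \<times> 'a) set set \<Rightarrow> bool" where
  "coarse_space X V \<longleftrightarrow>
     semi_coarse_space X V \<and> (\<forall>A\<in>V. \<forall>B\<in>V. A O B \<in> V)"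

text \<open>Maps between carriers are extensional functions, so that equality of morphisms is
  equality of HOL functions; composition is \<^const>\<open>compose\<close> and the identity of
  \<open>X\<close> is \<open>\<lambda>x\<in>X. x\<close>.\<close>

definition bornologous ::
    "'a set \<Rightarrow> ('a \<times> 'a) set set \<Rightarrow> 'b set \<Rightarrow> ('b \<times> 'b) set set \<Rightarrow> ('a \<Rightarrow> 'b) \<Rightarrow> bool" where
  "bornologous X V Y W f \<longleftrightarrow>
     f \<in> X \<rightarrow>\<^sub>E Y \<and> (\<forall>A\<in>V. map_prod f f ` A \<in> W)"

definition set_product_ext :: "'a set \<Rightarrow> ('a \<times> 'a) set set \<Rightarrow> ('a \<times> 'a) set set" where
  "set_product_ext X V = {C. C \<subseteq> X \<times> X \<and> (\<exists>A\<in>V. \<exists>B\<in>V. C \<subseteq> A O B)}"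

primrec iter_product_ext :: "'a set \<Rightarrow> ('a \<times> 'a) set set \<Rightarrow> nat \<Rightarrow> ('a \<times> 'a) set set" where
  "iter_product_ext X V 0 = V"
| "iter_product_ext X V (Suc k) = set_product_ext X (iter_product_ext X V k)"

definition directed_system ::
    "(nat \<Rightarrow> 'a set) \<Rightarrow> (nat \<Rightarrow> ('a \<times> 'a) set set) \<Rightarrow> (nat \<Rightarrow> nat \<Rightarrow> 'a \<Rightarrow> 'a) \<Rightarrow> bool" where
  "directed_system X V f \<longleftrightarrow>
     (\<forall>i. semi_coarse_space (X i) (V i)) \<and>
     (\<forall>i j. i \<le> j \<longrightarrow> bornologous (X i) (V i) (X j) (V j) (f i j)) \<and>
     (\<forall>i. f i i = (\<lambda>x\<in>X i. x)) \<and>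
     (\<forall>i j k. i \<le> j \<longrightarrow> j \<le> k \<longrightarrow> compose (X i) (f j k) (f i j) = f i k)"

definition cocone ::
    "(nat \<Rightarrow> 'a set) \<Rightarrow> (nat \<Rightarrow> ('a \<times> 'a) set set) \<Rightarrow> (nat \<Rightarrow> nat \<Rightarrow> 'a \<Rightarrow> 'a) \<Rightarrow>
     'b set \<Rightarrow> ('b \<times> 'b) set set \<Rightarrow> (nat \<Rightarrow> 'a \<Rightarrow> 'b) \<Rightarrow> bool" where
  "cocone X V f Y W \<psi> \<longleftrightarrow>
     semi_coarse_space Y W \<and>
     (\<forall>i. bornologous (X i) (V i) Y W (\<psi> i)) \<and>
     (\<forall>i j. i \<le> j \<longrightarrow> compose (X i) (\<psi> j) (f i j) = \<psi> i)"

text \<open>Direct limit by its universal property in the category of semi-coarse spaces.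
  HOL cannot quantify over types inside a formula, so the type \<open>'t\<close> carrying the
  test spaces is a parameter.\<close>

definition is_direct_limit ::
    "'t itself \<Rightarrow> (nat \<Rightarrow> 'a set) \<Rightarrow> (nat \<Rightarrow> ('a \<times> 'a) set set) \<Rightarrow> (nat \<Rightarrow> nat \<Rightarrow> 'a \<Rightarrow> 'a) \<Rightarrow>
     'b set \<Rightarrow> ('b \<times> 'b) set set \<Rightarrow> (nat \<Rightarrow> 'a \<Rightarrow> 'b) \<Rightarrow> bool" where
  "is_direct_limit _ X V f L W \<phi> \<longleftrightarrow>
     cocone X V f L W \<phi> \<and>
     (\<forall>(Y :: 't set) U \<psi>. cocone X V f Y U \<psi> \<longrightarrow>
        (\<exists>!u. bornologous L W Y U u \<and> (\<forall>i. compose (X i) u (\<phi> i) = \<psi> i)))"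

end

theory Submission
  imports Defs
begin

text \<open>The structures \<open>V\<^sup>k\<^sup>P\<^sup>E\<close> increase with \<open>k\<close>, and the composite of two members of
  the \<open>k\<close>-th one lies in the next; hence their union is closed under composition. A cocone over a
  system of identity maps is a single function, so the union is a direct limit. Any other direct
  limit is isomorphic to it, and composition-closure passes along isomorphisms.\<close>

section \<open>Set product extensions and the union of their iterates\<close>

lemma semi_coarse_spaceD:
  assumes "semi_coarse_space X V"
  shows "\<And>A. A \<in> V \<Longrightarrow> A \<subseteq> X \<times> X"
    and "Id_on X \<in> V"
    and "\<And>A B. A \<in> V \<Longrightarrow> B \<subseteq> A \<Longrightarrow> B \<in> V"
    and "\<And>A B. A \<in> V \<Longrightarrow> B \<in> V \<Longrightarrow> A \<union> B \<in> V"
    and "\<And>A. A \<in> V \<Longrightarrow> A\<inverse> \<in> V"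
  using assms unfolding semi_coarse_space_def by (simp_all add: subset_iff)

lemma relcomp_in_set_product_ext:
  assumes "semi_coarse_space X V" "A \<in> V" "B \<in> V"
  shows "A O B \<in> set_product_ext X V"
proof -
  have "A O B \<subseteq> X \<times> X"
    using semi_coarse_spaceD(1)[OF assms(1)] assms(2,3) by blast
  then show ?thesis
    using assms(2,3) unfolding set_product_ext_def by blast
qed

text \<open>The diagonal is a right unit: every \<open>A\<close> in \<open>V\<close> equals
  \<open>A O Id_on X\<close>, a composite of two members of \<open>V\<close>.\<close>

lemma set_product_ext_increasing:
  assumes "semi_coarse_space X V"
  shows "V \<subseteq> set_product_ext X V"
proof
  fix A assume A: "A \<in> V"
  have "A O Id_on X = A"
    using semi_coarse_spaceD(1)[OF assms A] by auto
  then show "A \<in> set_product_ext X V"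
    using relcomp_in_set_product_ext[OF assms A semi_coarse_spaceD(2)[OF assms]] by simp
qed

text \<open>Composition is monotone, so joining the left factors and the right factors separately
  covers a union of two composites. Taking inverses swaps the two factors.\<close>

lemma semi_coarse_space_set_product_ext:
  assumes "semi_coarse_space X V"
  shows "semi_coarse_space X (set_product_ext X V)"
  unfolding semi_coarse_space_def
proof (intro conjI ballI allI impI)
  show "set_product_ext X V \<subseteq> Pow (X \<times> X)"
    unfolding set_product_ext_def by blast
  show "Id_on X \<in> set_product_ext X V"
    using semi_coarse_spaceD(2)[OF assms] set_product_ext_increasing[OF assms] by blast
next
  fix C D assume "C \<in> set_product_ext X V" "D \<subseteq> C"
  then show "D \<in> set_product_ext X V"
    unfolding set_product_ext_def by blast
next
  fix C D assume "C \<in> set_product_ext X V" "D \<in> set_product_ext X V"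
  then obtain A B A' B' where *: "A \<in> V" "B \<in> V" "A' \<in> V" "B' \<in> V"
    "C \<subseteq> A O B" "D \<subseteq> A' O B'" "C \<subseteq> X \<times> X" "D \<subseteq> X \<times> X"
    unfolding set_product_ext_def by blast
  have "A \<union> A' \<in> V" "B \<union> B' \<in> V"
    using * semi_coarse_spaceD(4)[OF assms] by blast+
  moreover have "C \<union> D \<subseteq> (A \<union> A') O (B \<union> B')" "C \<union> D \<subseteq> X \<times> X"
    using * by blast+
  ultimately show "C \<union> D \<in> set_product_ext X V"
    unfolding set_product_ext_def by blast
next
  fix C assume "C \<in> set_product_ext X V"
  then obtain A B where *: "A \<in> V" "B \<in> V" "C \<subseteq> A O B" "C \<subseteq> X \<times> X"
    unfolding set_product_ext_def by blast
  have "A\<inverse> \<in> V" "B\<inverse> \<in> V"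
    using * semi_coarse_spaceD(5)[OF assms] by blast+
  moreover have "C\<inverse> \<subseteq> B\<inverse> O A\<inverse>" "C\<inverse> \<subseteq> X \<times> X"
    using * by blast+
  ultimately show "C\<inverse> \<in> set_product_ext X V"
    unfolding set_product_ext_def by blast
qed

lemma semi_coarse_space_iter_product_ext:
  assumes "semi_coarse_space X V"
  shows "semi_coarse_space X (iter_product_ext X V k)"
  by (induction k) (simp_all add: assms semi_coarse_space_set_product_ext)

lemma iter_product_ext_mono:
  assumes "semi_coarse_space X V" "i \<le> j"
  shows "iter_product_ext X V i \<subseteq> iter_product_ext X V j"
proof (rule lift_Suc_mono_le[OF _ assms(2)])
  show "iter_product_ext X V k \<subseteq> iter_product_ext X V (Suc k)" for k
    using set_product_ext_increasing[OF semi_coarse_space_iter_product_ext[OF assms(1)]] by simp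
qed

lemma coarse_space_Union_iter_product_ext:
  assumes "semi_coarse_space X V"
  shows "coarse_space X (\<Union>k. iter_product_ext X V k)"
proof -
  let ?V = "iter_product_ext X V" and ?U = "\<Union>k. iter_product_ext X V k"
  note sc = semi_coarse_space_iter_product_ext[OF assms]
  \<comment> \<open>The stages increase, so two members of the union already meet in one stage. The
    closure conditions with two arguments can then be checked there.\<close>
  have common: "\<exists>k. A \<in> ?V k \<and> B \<in> ?V k" if AB: "A \<in> ?U" "B \<in> ?U" for A B
  proof -
    obtain i j where "A \<in> ?V i" "B \<in> ?V j"
      using AB by blast
    then have "A \<in> ?V (max i j)" "B \<in> ?V (max i j)"
      using iter_product_ext_mono[OF assms, of i "max i j"]
        iter_product_ext_mono[OF assms, of j "max i j"] by auto
    then show ?thesis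
      by blast
  qed
  show ?thesis
    unfolding coarse_space_def semi_coarse_space_def
  proof (intro conjI ballI allI impI)
    show "?U \<subseteq> Pow (X \<times> X)"
      using semi_coarse_spaceD(1)[OF sc] by auto
    show "Id_on X \<in> ?U"
      using semi_coarse_spaceD(2)[OF sc] by auto
  next
    fix A B assume "A \<in> ?U" "B \<subseteq> A"
    then show "B \<in> ?U"
      using semi_coarse_spaceD(3)[OF sc, of A _ B] by auto
  next
    fix A assume "A \<in> ?U"
    then show "A\<inverse> \<in> ?U"
      using semi_coarse_spaceD(5)[OF sc] by auto
  next
    fix A B assume "A \<in> ?U" "B \<in> ?U"
    from common[OF this] obtain k where k: "A \<in> ?V k" "B \<in> ?V k"
      by auto
    show "A \<union> B \<in> ?U"
      using semi_coarse_spaceD(4)[OF sc k] by auto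
  next
    fix A B assume "A \<in> ?U" "B \<in> ?U"
    from common[OF this] obtain k where k: "A \<in> ?V k" "B \<in> ?V k"
      by auto
    \<comment> \<open>Stage \<open>k\<close> need not contain the composite, but the next stage does
      by construction. The union absorbs this shift.\<close>
    have "A O B \<in> ?V (Suc k)"
      using relcomp_in_set_product_ext[OF sc k] by simp
    then show "A O B \<in> ?U"
      by (rule UN_I[OF UNIV_I])
  qed
qed

section \<open>Bornologous maps and systems of identity maps\<close>

lemma bornologous_id:
  assumes "\<And>A. A \<in> V \<Longrightarrow> A \<subseteq> X \<times> X" "V \<subseteq> W"
  shows "bornologous X V X W (\<lambda>x\<in>X. x)"
  unfolding bornologous_def
proof (intro conjI ballI)
  fix A assume A: "A \<in> V"
  \<comment> \<open>The restricted identity fixes only the points of \<open>X\<close>; it fixes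
    \<open>A\<close> as a set because \<open>A\<close> lies in \<open>X \<times> X\<close>.\<close>
  have "map_prod (\<lambda>x\<in>X. x) (\<lambda>x\<in>X. x) ` A = (\<lambda>p. p) ` A"
    using assms(1)[OF A] by (intro image_cong) auto
  then show "map_prod (\<lambda>x\<in>X. x) (\<lambda>x\<in>X. x) ` A \<in> W"
    using A assms(2) by auto
qed auto

lemma bornologous_compose:
  assumes "bornologous X V Y W f" "bornologous Y W Z U g" "\<And>A. A \<in> V \<Longrightarrow> A \<subseteq> X \<times> X"
  shows "bornologous X V Z U (compose X g f)"
  unfolding bornologous_def
proof (intro conjI ballI)
  show "compose X g f \<in> X \<rightarrow>\<^sub>E Z"
    using assms(1,2) unfolding bornologous_def by (auto simp: compose_def)
  fix A assume A: "A \<in> V"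
  have "map_prod (compose X g f) (compose X g f) ` A = map_prod g g ` map_prod f f ` A"
    unfolding image_image using assms(3)[OF A]
    by (intro image_cong) (auto simp: compose_def)
  then show "map_prod (compose X g f) (compose X g f) ` A \<in> U"
    using A assms(1,2) unfolding bornologous_def by simp
qed

lemma compose_id_right:
  "f \<in> extensional X \<Longrightarrow> compose X f (\<lambda>x\<in>X. x) = f"
  by (auto simp: compose_def fun_eq_iff extensional_def)

lemma bornologous_extensional:
  "bornologous X V Y W f \<Longrightarrow> f \<in> extensional X"
  unfolding bornologous_def PiE_def by blast

text \<open>Compatibility along the transition map from stage 0 to stage \<open>k\<close> forces all
  legs to agree. The common leg is bornologous on the union because each member of the union belongs
  to some stage.\<close>

lemma cocone_identity_system:
  assumes "cocone (\<lambda>k. X) V (\<lambda>i j. \<lambda>x\<in>X. x) Y W \<psi>"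
  shows "\<psi> i = \<psi> 0" "bornologous X (\<Union>k. V k) Y W (\<psi> 0)"
proof -
  have b: "bornologous X (V k) Y W (\<psi> k)" for k
    using assms unfolding cocone_def by blast
  have eq: "\<psi> k = \<psi> 0" for k
  proof -
    have "compose X (\<psi> k) (\<lambda>x\<in>X. x) = \<psi> 0"
      using assms unfolding cocone_def by simp
    then show ?thesis
      using compose_id_right[OF bornologous_extensional[OF b]] by simp
  qed
  show "\<psi> i = \<psi> 0"
    by (rule eq)
  have "bornologous X (V k) Y W (\<psi> 0)" for k
    using b[of k] by (simp only: eq[of k])
  then show "bornologous X (\<Union>k. V k) Y W (\<psi> 0)"
    unfolding bornologous_def by auto
qed

lemma directed_system_identity:
  assumes "\<And>k. semi_coarse_space X (V k)" "\<And>i j. i \<le> j \<Longrightarrow> V i \<subseteq> V j"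
  shows "directed_system (\<lambda>k. X) V (\<lambda>i j. \<lambda>x\<in>X. x)"
  unfolding directed_system_def
  using assms bornologous_id[OF semi_coarse_spaceD(1)[OF assms(1)]]
  by (simp add: compose_id_right)

text \<open>Composing with the identity leg returns the mediating map itself, so it can only be the
  common leg \<open>\<psi> 0\<close> of the given cocone.\<close>

lemma is_direct_limit_identity_system:
  assumes "\<And>k. semi_coarse_space X (V k)" "semi_coarse_space X (\<Union>k. V k)"
  shows "is_direct_limit TYPE('t) (\<lambda>k. X) V (\<lambda>i j. \<lambda>x\<in>X. x) X (\<Union>k. V k) (\<lambda>k. \<lambda>x\<in>X. x)"
  unfolding is_direct_limit_def
proof (intro conjI allI impI)
  have "bornologous X (V i) X (\<Union>k. V k) (\<lambda>x\<in>X. x)" for i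
    by (rule bornologous_id[OF semi_coarse_spaceD(1)[OF assms(1)]]) auto
  then show "cocone (\<lambda>k. X) V (\<lambda>i j. \<lambda>x\<in>X. x) X (\<Union>k. V k) (\<lambda>k. \<lambda>x\<in>X. x)"
    unfolding cocone_def using assms(2) by (simp add: compose_id_right)
next
  fix Y :: "'t set" and U \<psi>
  assume "cocone (\<lambda>k. X) V (\<lambda>i j. \<lambda>x\<in>X. x) Y U \<psi>"
  note \<psi> = cocone_identity_system[OF this]
  show "\<exists>!u. bornologous X (\<Union>k. V k) Y U u \<and> (\<forall>i. compose X u (\<lambda>x\<in>X. x) = \<psi> i)"
  proof (rule ex1I[of _ "\<psi> 0"])
    show "bornologous X (\<Union>k. V k) Y U (\<psi> 0) \<and> (\<forall>i. compose X (\<psi> 0) (\<lambda>x\<in>X. x) = \<psi> i)"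
      using \<psi>(2) compose_id_right[OF bornologous_extensional[OF \<psi>(2)]] \<psi>(1)[symmetric] by auto
  next
    fix u
    assume u: "bornologous X (\<Union>k. V k) Y U u \<and> (\<forall>i. compose X u (\<lambda>x\<in>X. x) = \<psi> i)"
    then show "u = \<psi> 0"
      using compose_id_right[OF bornologous_extensional[OF conjunct1[OF u]]] by simp
  qed
qed

section \<open>Arbitrary direct limits\<close>

text \<open>Push both relations into \<open>U\<close> along \<open>u\<close>, compose them there and
  push the result back along \<open>v\<close>. Since \<open>v\<close> undoes \<open>u\<close> on
  \<open>L\<close>, the outcome contains \<open>A O B\<close>, and \<open>W\<close> is closed under
  subsets.\<close>

lemma coarse_space_retract:
  assumes "coarse_space X U" "semi_coarse_space L W"
    and u: "bornologous L W X U u" and v: "bornologous X U L W v"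
    and vu: "\<And>y. y \<in> L \<Longrightarrow> v (u y) = y"
  shows "coarse_space L W"
  unfolding coarse_space_def
proof (intro conjI ballI)
  fix A B assume A: "A \<in> W" and B: "B \<in> W"
  let ?C = "(map_prod u u ` A) O (map_prod u u ` B)"
  have "map_prod u u ` A \<in> U" "map_prod u u ` B \<in> U"
    using A B u unfolding bornologous_def by blast+
  then have "?C \<in> U"
    using assms(1) unfolding coarse_space_def by blast
  then have W: "map_prod v v ` ?C \<in> W"
    using v unfolding bornologous_def by blast
  have "A O B \<subseteq> map_prod v v ` ?C"
  proof
    fix p assume "p \<in> A O B"
    then obtain x y z where p: "p = (x, z)" "(x, y) \<in> A" "(y, z) \<in> B"
      by blast
    have "x \<in> L" "z \<in> L"
      using p semi_coarse_spaceD(1)[OF assms(2)] A B by blast+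
    then have "p = map_prod v v (u x, u z)"
      using p(1) vu by simp
    moreover have "(u x, u z) \<in> ?C"
      using p(2,3) by (auto intro!: relcompI[of _ "u y"] image_eqI)
    ultimately show "p \<in> map_prod v v ` ?C"
      by (rule image_eqI)
  qed
  then show "A O B \<in> W"
    by (rule semi_coarse_spaceD(3)[OF assms(2) W])
qed (rule assms(2))

text \<open>The two test types have different tasks: testing against \<open>X\<close> with the union
  yields \<open>u\<close> from \<open>L\<close> to \<open>X\<close>, and testing against
  \<open>L\<close> itself shows that \<open>\<phi> 0\<close> undoes \<open>u\<close>.\<close>

lemma coarse_space_direct_limit_identity_system:
  fixes X :: "'a set" and L :: "'b set"
  assumes V: "\<And>k. semi_coarse_space X (V k)" and U: "coarse_space X (\<Union>k. V k)"
    and lim_a: "is_direct_limit TYPE('a) (\<lambda>k. X) V (\<lambda>i j. \<lambda>x\<in>X. x) L W \<phi>"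
    and lim_b: "is_direct_limit TYPE('b) (\<lambda>k. X) V (\<lambda>i j. \<lambda>x\<in>X. x) L W \<phi>"
  shows "coarse_space L W"
proof -
  let ?U = "\<Union>k. V k" and ?id = "\<lambda>x\<in>X. x"
  have scU: "semi_coarse_space X ?U"
    using U unfolding coarse_space_def by blast
  have cocone_\<phi>: "cocone (\<lambda>k. X) V (\<lambda>i j. ?id) L W \<phi>"
    using lim_b unfolding is_direct_limit_def by blast
  then have scL: "semi_coarse_space L W"
    unfolding cocone_def by blast
  note \<phi> = cocone_identity_system[OF cocone_\<phi>]
  have "cocone (\<lambda>k. X) V (\<lambda>i j. ?id) X ?U (\<lambda>k. ?id)"
    using is_direct_limit_identity_system[OF V scU] unfolding is_direct_limit_def by blast
  then obtain u where u: "bornologous L W X ?U u" "\<And>i. compose X u (\<phi> i) = ?id"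
    using lim_a unfolding is_direct_limit_def by blast
  let ?w = "compose L (\<phi> 0) u" and ?idL = "\<lambda>y\<in>L. y"
  have \<phi>L: "\<phi> i x \<in> L" if "x \<in> X" for i x
    using \<phi> that unfolding bornologous_def by (metis PiE_mem)
  have u\<phi>: "u (\<phi> i x) = x" if "x \<in> X" for i x
    using fun_cong[OF u(2)[of i], of x] that by (simp add: compose_def)
  have ext: "\<phi> i \<in> extensional X" for i
    using bornologous_extensional[OF \<phi>(2)] \<phi>(1) by metis
  \<comment> \<open>Both \<open>?w\<close> and \<open>?idL\<close> are shown to mediate from the
    limit cocone to itself; uniqueness then identifies them. The functions are extensional, so
    agreement on \<open>X\<close> suffices for the equalities of legs.\<close>
  have "compose X ?w (\<phi> i) = \<phi> i" for i
  proof (rule extensionalityI[OF _ ext])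
    show "compose X ?w (\<phi> i) x = \<phi> i x" if "x \<in> X" for x
      using that \<phi>L[OF that, of i] u\<phi>[OF that, of i] \<phi>(1)[of i] by (simp add: compose_def)
  qed (simp add: compose_def)
  moreover have "compose X ?idL (\<phi> i) = \<phi> i" for i
    by (rule extensionalityI[OF _ ext]) (simp_all add: compose_def \<phi>L)
  moreover have "bornologous L W L W ?w"
    by (rule bornologous_compose[OF u(1) \<phi>(2) semi_coarse_spaceD(1)[OF scL]])
  moreover have "bornologous L W L W ?idL"
    by (rule bornologous_id[OF semi_coarse_spaceD(1)[OF scL]]) auto
  moreover have "\<exists>!w. bornologous L W L W w \<and> (\<forall>i. compose X w (\<phi> i) = \<phi> i)"
    using lim_b cocone_\<phi> unfolding is_direct_limit_def by blast
  ultimately have w: "?w = ?idL"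
    by blast
  have "\<phi> 0 (u y) = y" if "y \<in> L" for y
    using fun_cong[OF w, of y] that by (simp add: compose_def)
  then show ?thesis
    by (rule coarse_space_retract[OF U scL u(1) \<phi>(2)])
qed

text \<open>A direct limit is determined only up to isomorphism. The statement therefore covers the
  concrete union, tested against an arbitrary type \<open>'t\<close>, and also every limit
  \<open>L\<close> tested against the types of \<open>X\<close> and \<open>L\<close>.\<close>

theorem theoremA3p14:
  fixes X :: "'a set" and V :: "('a \<times> 'a) set set"
  assumes "semi_coarse_space X V"
  shows "directed_system (\<lambda>k. X) (iter_product_ext X V) (\<lambda>i j. \<lambda>x\<in>X. x) \<and>
    is_direct_limit TYPE('t) (\<lambda>k. X) (iter_product_ext X V) (\<lambda>i j. \<lambda>x\<in>X. x)
      X (\<Union>k. iter_product_ext X V k) (\<lambda>k. \<lambda>x\<in>X. x) \<and>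
    coarse_space X (\<Union>k. iter_product_ext X V k) \<and>
    (\<forall>(L :: 'b set) W \<phi>.
       is_direct_limit TYPE('a) (\<lambda>k. X) (iter_product_ext X V) (\<lambda>i j. \<lambda>x\<in>X. x) L W \<phi> \<longrightarrow>
       is_direct_limit TYPE('b) (\<lambda>k. X) (iter_product_ext X V) (\<lambda>i j. \<lambda>x\<in>X. x) L W \<phi> \<longrightarrow>
       coarse_space L W)"
proof -
  let ?V = "iter_product_ext X V"
  note sc = semi_coarse_space_iter_product_ext[OF assms]
  note U = coarse_space_Union_iter_product_ext[OF assms]
  have scU: "semi_coarse_space X (\<Union>k. ?V k)"
    using U unfolding coarse_space_def by blast
  have "directed_system (\<lambda>k. X) ?V (\<lambda>i j. \<lambda>x\<in>X. x)"
    using sc iter_product_ext_mono[OF assms] by (rule directed_system_identity)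
  then show ?thesis
    using is_direct_limit_identity_system[OF sc scU] U
      coarse_space_direct_limit_identity_system[OF sc U] by blast
qed

end
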